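(* Let $c_4 = \sqrt[40]{\theta(40)}$, where $\theta(40) = 22388184630824$ (so $c_4 = 2.156\ldots$). Then for all positive integers $n$, \[ \theta(n) \geq \frac{n\, c_4^n}{40}. \]
   Context: For a positive integer $n$, let $[n]=\{1,2,\ldots,n\}$. A permutation $(a_1,a_2,\ldots,a_n)$ of $[n]$ is called 3-free if there do not exist indices $i<j<k$ with $a_i + a_k = 2a_j$, i.e., it contains no 3-term arithmetic progression as a subsequence. $\theta(n)$ denotes the number of 3-free permutations of $[n]$. *)

theory Defs
  imports
    Complex_Main
    "HOL-Combinatorics.Multiset_Permutations"
begin

definition three_free :: "nat list \<Rightarrow> bool" where
  "three_free a \<longleftrightarrow>
     \<not> (\<exists>i j k. i < j \<and> j < k \<and> k < length a \<and> a ! i + a ! k = 2 * a ! j)"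

definition theta :: "nat \<Rightarrow> nat" where
  "theta n = card {a \<in> permutations_of_set {1..n}. three_free a}"

end

theory Submission
  imports Defs
begin

text \<open>
  Listing all odd numbers before all even numbers, or conversely, gives
  \<open>theta (m + n) \<ge> 2 * theta m * theta n\<close> for \<open>n \<le> m \<le> n + 1\<close>. If the claim holds for
  \<open>m, n \<ge> 40\<close>, it follows for \<open>m + n\<close> because \<open>2 * m * n \<ge> 40 * (m + n)\<close>, so it suffices to verify it
  below 80, which the doubling inequality reduces to the values of \<open>theta\<close> up to 28 and from 36 to 44.

  A permutation is 3-free iff each entry \<open>x\<close> is placed when the set \<open>S\<close> of earlier entries is
  symmetric about \<open>x\<close> within the range. Hence \<open>theta n\<close> counts the paths from the empty to the full set
  in the graph of such moves. The number of paths to each set of size \<open>k\<close> is computed for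
  \<open>k = 0, 1, \<dots>\<close>. This is feasible because sets that cannot be completed are discarded
  early: a 4-term progression of which exactly the outer terms are in \<open>S\<close> blocks both inner terms.
  For \<open>n = 40\<close> only about 12000 sets remain.
\<close>

section \<open>3-free permutations as sequences of admissible moves\<close>

text \<open>The numbers are shifted to \<open>0, \<dots>, n - 1\<close>. The last two conditions forbid moves into
  dead ends; they hold automatically along a 3-free permutation.\<close>

definition admissible :: "nat \<Rightarrow> nat set \<Rightarrow> nat \<Rightarrow> bool" where
  "admissible n S x \<longleftrightarrow> x < n \<and> x \<notin> S
     \<and> (\<forall>d>0. d \<le> x \<and> x + d < n \<longrightarrow> (x - d \<in> S \<longleftrightarrow> x + d \<in> S))
     \<and> (\<forall>d>0. 3 * d \<le> x \<and> x - 3 * d \<in> S \<longrightarrow> x - d \<in> S \<or> x - 2 * d \<in> S)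
     \<and> (\<forall>d>0. x + 3 * d < n \<and> x + 3 * d \<in> S \<longrightarrow> x + d \<in> S \<or> x + 2 * d \<in> S)"

fun admissible_seq :: "nat \<Rightarrow> nat set \<Rightarrow> nat list \<Rightarrow> bool" where
  "admissible_seq n S [] \<longleftrightarrow> True"
| "admissible_seq n S (x # xs) \<longleftrightarrow> admissible n S x \<and> admissible_seq n (insert x S) xs"

lemma admissible_seq_iff:
  "admissible_seq n S xs \<longleftrightarrow> (\<forall>j<length xs. admissible n (S \<union> set (take j xs)) (xs ! j))"
  by (induction xs arbitrary: S) (auto simp: All_less_Suc2)

lemma admissible_seq_distinct:
  "admissible_seq n S xs \<Longrightarrow> distinct xs \<and> set xs \<subseteq> {..<n} - S"
  by (induction xs arbitrary: S) (auto simp: admissible_def)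

text \<open>When the middle term of a progression is placed, one outer term is already in
  \<open>S\<close> and the other is not, which violates the symmetry condition.\<close>

lemma admissible_seq_imp_three_free:
  assumes "admissible_seq n {} xs"
  shows "three_free xs"
  unfolding three_free_def
proof (intro notI, elim exE conjE)
  fix i j k
  assume ijk: "i < j" "j < k" "k < length xs" and ap: "xs ! i + xs ! k = 2 * xs ! j"
  define S where "S = set (take j xs)"
  have dist: "distinct xs" and range: "set xs \<subseteq> {..<n}"
    using admissible_seq_distinct[OF assms] by auto
  have adm: "admissible n S (xs ! j)"
    using assms ijk unfolding admissible_seq_iff S_def by auto
  have sym: "u \<in> S \<longleftrightarrow> v \<in> S" if "u < v" "v < n" "u + v = 2 * xs ! j" for u v
  proof -
    have "xs ! j - (v - xs ! j) = u" "xs ! j + (v - xs ! j) = v"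
      "v - xs ! j > 0" "v - xs ! j \<le> xs ! j"
      using that by auto
    thus ?thesis
      using adm that(2) unfolding admissible_def by metis
  qed
  have "xs ! i \<in> S"
    using ijk unfolding S_def by (auto simp: in_set_conv_nth intro!: exI[of _ i])
  moreover have "xs ! k \<notin> S"
    using ijk dist unfolding S_def by (auto simp: in_set_conv_nth nth_eq_iff_index_eq)
  moreover have "xs ! i < n" "xs ! k < n"
    using range ijk nth_mem by (fastforce simp: subset_iff)+
  moreover have "xs ! i \<noteq> xs ! k"
    using dist ijk by (auto simp: nth_eq_iff_index_eq)
  ultimately show False
    using sym[of "xs ! i" "xs ! k"] sym[of "xs ! k" "xs ! i"] ap
    by (auto simp: add.commute linorder_neq_iff)
qed

text \<open>Every number outside \<open>S\<close> other than \<open>x\<close> is placed after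
  \<open>x\<close>. A failed symmetry condition thus makes \<open>x\<close> the middle term of a
  progression in order of placement; a failed gap condition is refuted by
  \<open>no_gap\<close>.\<close>

lemma three_free_imp_admissible_seq:
  assumes tf: "three_free xs" and dist: "distinct xs" and set: "set xs = {..<n}"
  shows "admissible_seq n {} xs"
  unfolding admissible_seq_iff
proof (intro allI impI)
  fix j
  assume j: "j < length xs"
  define x where "x = xs ! j"
  define S where "S = set (take j xs)"
  have xn: "x < n" using j set nth_mem unfolding x_def by fastforce
  have before: "\<exists>i<j. xs ! i = y" if "y \<in> S" for y
    using that j unfolding S_def by (auto simp: in_set_conv_nth)
  have after: "\<exists>k>j. k < length xs \<and> xs ! k = y" if y: "y < n" "y \<notin> S" "y \<noteq> x" for y
  proof -
    obtain k where k: "k < length xs" "xs ! k = y"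
      using y(1) set by (metis in_set_conv_nth lessThan_iff)
    have "\<not> k < j"
      using y(2) k unfolding S_def by (auto simp: in_set_conv_nth)
    moreover have "k \<noteq> j"
      using y(3) k unfolding x_def by auto
    ultimately show ?thesis using k by (intro exI[of _ k]) auto
  qed
  have no_ap: False if "i < j'" "j' < k" "k < length xs" "xs ! i + xs ! k = 2 * xs ! j'" for i j' k
    using tf that unfolding three_free_def by blast
  have no_ap_x: False if "y \<in> S" "z \<notin> S" "z < n" "y + z = 2 * x" "z \<noteq> x" for y z
    using before[OF that(1)] after[of z] that no_ap[of _ j] unfolding x_def by metis
  \<comment> \<open>The numbers \<open>a\<close>, \<open>c\<close>, \<open>b\<close>,
    \<open>x\<close> form a 4-term progression whose inner terms are both still missing. If
    \<open>b\<close> comes before \<open>c\<close>, then \<open>x\<close>, \<open>b\<close>,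
    \<open>c\<close> is a forbidden subsequence; otherwise \<open>a\<close>, \<open>c\<close>,
    \<open>b\<close> is one.\<close>
  have no_gap: False
    if abc: "a \<in> S" "b \<notin> S" "c \<notin> S" "b < n" "c < n" "x + c = 2 * b" "a + b = 2 * c" "b \<noteq> x" "c \<noteq> x" for a b c
  proof -
    obtain i k l where *: "i < j" "xs ! i = a" "j < k" "k < length xs" "xs ! k = b"
      "j < l" "l < length xs" "xs ! l = c"
      using before[of a] after[of b] after[of c] abc by metis
    have "k \<noteq> l" using abc * by auto
    then consider "k < l" | "l < k" by linarith
    thus False
    proof cases
      case 1
      thus False using no_ap[of j k l] * abc unfolding x_def by simp
    next
      case 2
      thus False using no_ap[of i l k] * abc by simp
    qed
  qed
  have "x \<notin> S"
    using dist j unfolding x_def S_def by (auto simp: in_set_conv_nth nth_eq_iff_index_eq)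
  moreover have "x - d \<in> S \<longleftrightarrow> x + d \<in> S" if "d > 0" "d \<le> x" "x + d < n" for d
  proof -
    have "x - d < n" "x - d + (x + d) = 2 * x" "x - d \<noteq> x" "x + d \<noteq> x"
      using that xn by auto
    thus ?thesis
      using no_ap_x[of "x - d" "x + d"] no_ap_x[of "x + d" "x - d"] that(3) by (auto simp: add.commute)
  qed
  moreover have "x - d \<in> S \<or> x - 2 * d \<in> S" if "d > 0" "3 * d \<le> x" "x - 3 * d \<in> S" for d
  proof (rule ccontr)
    assume "\<not> ?thesis"
    moreover have "x - d < n" "x - 2 * d < n" "x + (x - 2 * d) = 2 * (x - d)"
      "x - 3 * d + (x - d) = 2 * (x - 2 * d)" "x - d \<noteq> x" "x - 2 * d \<noteq> x"
      using that xn by auto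
    ultimately show False
      using no_gap[of "x - 3 * d" "x - d" "x - 2 * d"] that(3) by blast
  qed
  moreover have "x + d \<in> S \<or> x + 2 * d \<in> S" if "d > 0" "x + 3 * d < n" "x + 3 * d \<in> S" for d
    using no_gap[of "x + 3 * d" "x + d" "x + 2 * d"] that by auto
  ultimately show "admissible n ({} \<union> set (take j xs)) (xs ! j)"
    using xn unfolding admissible_def S_def x_def by auto
qed

lemma three_free_map_Suc: "three_free (map Suc xs) \<longleftrightarrow> three_free xs"
proof -
  have "(map Suc xs ! i + map Suc xs ! k = 2 * map Suc xs ! j) = (xs ! i + xs ! k = 2 * xs ! j)"
    if "i < j" "j < k" "k < length xs" for i j k
    using that by simp
  thus ?thesis unfolding three_free_def by (metis length_map)
qed

lemma theta_eq_card_admissible_seq: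
  "theta n = card {xs. length xs = n \<and> admissible_seq n {} xs}"
proof -
  let ?A = "{xs. length xs = n \<and> admissible_seq n {} xs}"
  let ?B = "{a \<in> permutations_of_set {1..n}. three_free a}"
  have iff: "xs \<in> ?A \<longleftrightarrow> distinct xs \<and> set xs = {..<n} \<and> three_free xs" for xs
  proof
    assume A: "xs \<in> ?A"
    hence "distinct xs" "set xs \<subseteq> {..<n}"
      using admissible_seq_distinct[of n "{}" xs] by auto
    moreover from this have "set xs = {..<n}"
      using A by (intro card_subset_eq) (auto simp: distinct_card)
    ultimately show "distinct xs \<and> set xs = {..<n} \<and> three_free xs"
      using A admissible_seq_imp_three_free by auto
  next
    assume "distinct xs \<and> set xs = {..<n} \<and> three_free xs"
    thus "xs \<in> ?A"
      using three_free_imp_admissible_seq by (metis (mono_tags) card_lessThan distinct_card mem_Collect_eq)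
  qed
  have "?B = map Suc ` ?A"
  proof (intro equalityI subsetI)
    fix a assume a: "a \<in> ?B"
    \<comment> \<open>All entries of \<open>a\<close> are at least 1, so truncated subtraction
      really inverts \<open>Suc\<close>.\<close>
    define xs where "xs = map (\<lambda>x. x - 1) a"
    have "map Suc xs = map id a"
      unfolding xs_def map_map using a by (intro map_cong) (auto simp: permutations_of_set_def)
    hence eq: "a = map Suc xs" by simp
    have "Suc ` set xs = Suc ` {..<n}"
      using a unfolding eq permutations_of_set_def by (auto simp: image_Suc_lessThan)
    hence "set xs = {..<n}" by (simp add: inj_image_eq_iff)
    moreover have "distinct xs" "three_free xs"
      using a unfolding eq permutations_of_set_def by (auto simp: distinct_map three_free_map_Suc)
    ultimately show "a \<in> map Suc ` ?A" using eq iff by blast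
  next
    fix a assume "a \<in> map Suc ` ?A"
    then obtain xs where "a = map Suc xs" "distinct xs" "set xs = {..<n}" "three_free xs"
      using iff by blast
    thus "a \<in> ?B"
      by (auto simp: permutations_of_set_def distinct_map three_free_map_Suc image_Suc_lessThan)
  qed
  moreover have "inj_on (map Suc) ?A"
    by (rule inj_onI) (simp add: inj_map_eq_map)
  ultimately show ?thesis unfolding theta_def by (simp only: card_image)
qed

section \<open>Counting continuations by their first move\<close>

definition extensions :: "nat \<Rightarrow> nat \<Rightarrow> nat set \<Rightarrow> nat list set" where
  "extensions n k S = {xs. length xs = k \<and> admissible_seq n S xs}"

lemma finite_admissible: "finite {x. admissible n S x}"
  by (rule finite_subset[of _ "{..<n}"]) (auto simp: admissible_def)

lemma extensions_0: "extensions n 0 S = {[]}"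
  by (auto simp: extensions_def)

lemma extensions_Suc:
  "extensions n (Suc k) S = (\<Union>x\<in>{x. admissible n S x}. (#) x ` extensions n k (insert x S))"
  by (auto simp: extensions_def length_Suc_conv)

lemma finite_extensions: "finite (extensions n k S)"
  by (induction k arbitrary: S) (auto simp: extensions_0 extensions_Suc finite_admissible)

lemma card_extensions_Suc:
  "card (extensions n (Suc k) S)
     = (\<Sum>x | admissible n S x. card (extensions n k (insert x S)))"
  unfolding extensions_Suc
  by (subst card_UN_disjoint) (auto simp: finite_admissible finite_extensions card_image)

section \<open>The doubling inequality\<close>

text \<open>The set counted by \<open>theta\<close>, for an arbitrary ground set, so that the odd
  and the even numbers can be ordered separately.\<close>

definition three_free_orders :: "nat set \<Rightarrow> nat list set" where
  "three_free_orders A = {a \<in> permutations_of_set A. three_free a}"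

lemma finite_three_free_orders: "finite (three_free_orders A)"
  by (simp add: three_free_orders_def)

lemma length_three_free_orders: "xs \<in> three_free_orders A \<Longrightarrow> length xs = card A"
  by (auto simp: three_free_orders_def permutations_of_set_def distinct_card)

lemma three_free_map:
  assumes f: "\<And>x y z. x \<in> set xs \<Longrightarrow> y \<in> set xs \<Longrightarrow> z \<in> set xs \<Longrightarrow> f x + f z = 2 * f y \<Longrightarrow> x + z = 2 * y"
    and "three_free xs"
  shows "three_free (map f xs)"
  unfolding three_free_def
proof (intro notI, elim exE conjE)
  fix i j k
  assume *: "i < j" "j < k" "k < length (map f xs)" "map f xs ! i + map f xs ! k = 2 * map f xs ! j"
  hence "f (xs ! i) + f (xs ! k) = 2 * f (xs ! j)"
    "xs ! i \<in> set xs" "xs ! j \<in> set xs" "xs ! k \<in> set xs"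
    by auto
  hence "xs ! i + xs ! k = 2 * xs ! j"
    using f by blast
  thus False
    using * assms(2) unfolding three_free_def by auto
qed

text \<open>If \<open>f\<close> reflects progressions, applying it entrywise keeps an order 3-free.
  It is used for the maps onto the odd and the even numbers.\<close>

lemma theta_le_card_three_free_orders:
  assumes "inj_on f {1..n}"
    and f: "\<And>x y z. x \<in> {1..n} \<Longrightarrow> y \<in> {1..n} \<Longrightarrow> z \<in> {1..n} \<Longrightarrow> f x + f z = 2 * f y \<Longrightarrow> x + z = 2 * y"
  shows "theta n \<le> card (three_free_orders (f ` {1..n}))"
proof -
  have "inj_on (map f) (three_free_orders {1..n})"
    using assms(1)
    by (intro inj_onI) (simp add: three_free_orders_def permutations_of_set_def inj_on_map_eq_map)
  moreover have "map f ` three_free_orders {1..n} \<subseteq> three_free_orders (f ` {1..n})"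
    using assms(1) f
    by (auto simp: three_free_orders_def permutations_of_set_def distinct_map intro!: three_free_map)
  ultimately show ?thesis
    unfolding theta_def three_free_orders_def[symmetric]
    by (metis card_inj_on_le finite_three_free_orders)
qed

text \<open>The outer terms of a progression have an even sum, hence equal parity, so they cannot
  lie in different blocks; a progression would then lie within one block.\<close>

lemma append_in_three_free_orders:
  assumes xs: "xs \<in> three_free_orders A" and ys: "ys \<in> three_free_orders B"
    and parity: "\<And>x y. x \<in> A \<Longrightarrow> y \<in> B \<Longrightarrow> even x \<noteq> even y"
  shows "xs @ ys \<in> three_free_orders (A \<union> B)"
proof -
  have *: "set xs = A" "distinct xs" "three_free xs" "set ys = B" "distinct ys" "three_free ys"
    using xs ys by (auto simp: three_free_orders_def permutations_of_set_def)
  have "three_free (xs @ ys)"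
    unfolding three_free_def
  proof (intro notI, elim exE conjE)
    fix i j k
    assume ijk: "i < j" "j < k" "k < length (xs @ ys)"
      and ap: "(xs @ ys) ! i + (xs @ ys) ! k = 2 * (xs @ ys) ! j"
    consider "k < length xs" | "i \<ge> length xs" | "i < length xs" "k \<ge> length xs" by linarith
    thus False
    proof cases
      case 1
      thus False using ijk ap *(3) unfolding three_free_def by (auto simp: nth_append)
    next
      case 2
      hence "ys ! (i - length xs) + ys ! (k - length xs) = 2 * ys ! (j - length xs)"
        "i - length xs < j - length xs" "j - length xs < k - length xs" "k - length xs < length ys"
        using ijk ap by (auto simp: nth_append)
      thus False using *(6) unfolding three_free_def by blast
    next
      case 3
      hence "even (xs ! i) \<noteq> even (ys ! (k - length xs))"
        using ijk * parity by (metis add.commute length_append less_diff_conv2 nth_mem)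
      moreover have "xs ! i + ys ! (k - length xs) = 2 * (xs @ ys) ! j"
        using ap 3 by (simp add: nth_append)
      hence "even (xs ! i + ys ! (k - length xs))" by simp
      ultimately show False by simp
    qed
  qed
  thus ?thesis
    using * parity by (auto simp: three_free_orders_def permutations_of_set_def)
qed

text \<open>The factor 2 comes from the two orders of the blocks. The resulting lists differ because
  the first entry reveals which block comes first.\<close>

lemma card_three_free_orders_Un:
  assumes parity: "\<And>x y. x \<in> A \<Longrightarrow> y \<in> B \<Longrightarrow> even x \<noteq> even y"
    and "finite A" "finite B" "A \<noteq> {}" "B \<noteq> {}"
  shows "2 * (card (three_free_orders A) * card (three_free_orders B))
    \<le> card (three_free_orders (A \<union> B))"
proof -
  let ?app = "\<lambda>(xs, ys). xs @ ys"
  let ?P = "three_free_orders A \<times> three_free_orders B"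
  let ?Q = "three_free_orders B \<times> three_free_orders A"
  have inj: "inj_on ?app ?P" "inj_on ?app ?Q"
    by (auto intro!: inj_onI simp: length_three_free_orders)
  have sub: "?app ` ?P \<union> ?app ` ?Q \<subseteq> three_free_orders (A \<union> B)"
  proof -
    have "ys @ xs \<in> three_free_orders (B \<union> A)"
      if "xs \<in> three_free_orders A" "ys \<in> three_free_orders B" for xs ys
      using that parity by (intro append_in_three_free_orders) blast+
    thus ?thesis
      using append_in_three_free_orders[of _ A _ B] parity by (auto simp: Un_commute)
  qed
  have hd: "hd (xs @ ys) \<in> C" if "xs \<in> three_free_orders C" "C \<noteq> {}" for xs ys C
    using that by (cases xs) (auto simp: three_free_orders_def permutations_of_set_def)
  have "?app ` ?P \<inter> ?app ` ?Q = {}"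
  proof -
    have "xs @ ys \<noteq> ys' @ xs'"
      if "xs \<in> three_free_orders A" "ys' \<in> three_free_orders B" for xs ys xs' ys'
      using hd[OF that(1) assms(4), of ys] hd[OF that(2) assms(5), of xs'] parity by metis
    thus ?thesis by fastforce
  qed
  hence "card (?app ` ?P \<union> ?app ` ?Q) = card (?app ` ?P) + card (?app ` ?Q)"
    by (intro card_Un_disjoint) (auto simp: finite_three_free_orders)
  also have "\<dots> = 2 * (card (three_free_orders A) * card (three_free_orders B))"
    by (simp add: card_image inj card_cartesian_product)
  finally show ?thesis
    using card_mono[OF finite_three_free_orders sub] by simp
qed

lemma theta_add:
  assumes "m = n \<or> m = Suc n" "n > 0"
  shows "2 * (theta m * theta n) \<le> theta (m + n)"
proof -
  let ?odds = "(\<lambda>x. 2 * x - 1) ` {1..m}" and ?evens = "(\<lambda>x. 2 * x) ` {1..n}"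
  have union: "?odds \<union> ?evens = {1..m + n}"
  proof (intro equalityI subsetI)
    fix x assume x: "x \<in> {1..m + n}"
    show "x \<in> ?odds \<union> ?evens"
    proof (cases "even x")
      case True
      then obtain y where "x = 2 * y" by blast
      thus ?thesis using x assms by auto
    next
      case False
      then obtain y where "x = 2 * y + 1" by (rule oddE)
      hence "x = 2 * Suc y - 1" "Suc y \<in> {1..m}" using x assms by auto
      thus ?thesis by blast
    qed
  qed (use assms in auto)
  have "theta m * theta n \<le> card (three_free_orders ?odds) * card (three_free_orders ?evens)"
    by (intro mult_le_mono theta_le_card_three_free_orders) (auto intro!: inj_onI)
  moreover have "2 * (card (three_free_orders ?odds) * card (three_free_orders ?evens))
      \<le> card (three_free_orders (?odds \<union> ?evens))"
    using assms by (intro card_three_free_orders_Un) auto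
  moreover have "theta (m + n) = card (three_free_orders (?odds \<union> ?evens))"
    unfolding union theta_def three_free_orders_def ..
  ultimately show ?thesis by linarith
qed

section \<open>Counting paths with tries\<close>

text \<open>Symmetry about the current position: both lists give the bits nearest first. The
  comparison ends with the shorter list, beyond which mirror images are out of range.\<close>

fun agree :: "bool list \<Rightarrow> bool list \<Rightarrow> bool" where
  "agree [] r = True"
| "agree l [] = True"
| "agree (a # l) (b # r) = (a = b \<and> agree l r)"

text \<open>The dead-end test, called with three copies of one list. They advance by 1, 2 and 3
  places, so the bits at distances d, 2d and 3d meet without index arithmetic.\<close>

fun gap_free :: "bool list \<Rightarrow> bool list \<Rightarrow> bool list \<Rightarrow> bool" where
  "gap_free (a # p) (_ # b # q) (_ # _ # c # r) = ((a \<or> b \<or> \<not> c) \<and> gap_free p q r)"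
| "gap_free p q r = True"

fun rev_onto :: "bool list \<Rightarrow> bool list \<Rightarrow> bool list" where
  "rev_onto [] r = r"
| "rev_onto (a # l) r = rev_onto l (a # r)"

lemma rev_onto_eq: "rev_onto l r = rev l @ r"
  by (induction l r rule: rev_onto.induct) auto

lemma all_nat_Suc: "(\<forall>d. P d) \<longleftrightarrow> P 0 \<and> (\<forall>d. P (Suc d))"
  by (metis nat.exhaust)

lemma agree_iff: "agree l r \<longleftrightarrow> (\<forall>d. d < length l \<and> d < length r \<longrightarrow> l ! d = r ! d)"
proof (induction l r rule: agree.induct)
  case (3 a l b r)
  thus ?case by (subst all_nat_Suc) simp
qed auto

lemma gap_free_iff:
  "gap_free p q r \<longleftrightarrow> (\<forall>d. d < length p \<and> 2 * d + 1 < length q \<and> 3 * d + 2 < length r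
     \<longrightarrow> p ! d \<or> q ! (2 * d + 1) \<or> \<not> r ! (3 * d + 2))"
proof (induction p q r rule: gap_free.induct)
  case (1 a p x b q y z c r)
  thus ?case by (subst all_nat_Suc) simp
qed auto

definition elements :: "bool list \<Rightarrow> nat set" where
  "elements u = {i. i < length u \<and> u ! i}"

lemma elements_update: "i < length u \<Longrightarrow> elements (u[i := True]) = insert i (elements u)"
  by (auto simp: elements_def nth_list_update)

lemma admissible_less: "admissible n S x \<Longrightarrow> x < n"
  by (simp add: admissible_def)

text \<open>The bit at distance \<open>Suc d\<close> from the current position is
  \<open>L ! d\<close> on the left and \<open>R ! d\<close> on the right. With distances shifted by
  one, each condition of \<open>admissible\<close> becomes one list test.\<close>

lemma admissible_zipper:
  "admissible (length (rev L @ a # R)) (elements (rev L @ a # R)) (length L)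
     \<longleftrightarrow> \<not> a \<and> agree L R \<and> gap_free L L L \<and> gap_free R R R"
proof -
  define u where "u = rev L @ a # R"
  define x where "x = length L"
  have len: "length u = x + Suc (length R)" unfolding u_def x_def by simp
  have here: "x \<in> elements u \<longleftrightarrow> a"
    unfolding u_def x_def elements_def by (simp add: nth_append)
  have left: "x - Suc d \<in> elements u \<longleftrightarrow> L ! d" if "d < length L" for d
    using that unfolding u_def x_def elements_def by (auto simp: nth_append rev_nth)
  have right: "x + Suc d \<in> elements u \<longleftrightarrow> R ! d" if "d < length R" for d
    using that unfolding u_def x_def elements_def by (auto simp: nth_append)
  have pos: "(\<forall>d>0. P d) \<longleftrightarrow> (\<forall>d. P (Suc d))" for P :: "nat \<Rightarrow> bool"
    by (metis gr0_conv_Suc zero_less_Suc)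
  have mult: "2 * Suc d = Suc (2 * d + 1)" "3 * Suc d = Suc (3 * d + 2)" for d by simp_all
  have "(\<forall>d>0. d \<le> x \<and> x + d < length u \<longrightarrow> (x - d \<in> elements u \<longleftrightarrow> x + d \<in> elements u))
      \<longleftrightarrow> agree L R"
    unfolding pos agree_iff len using left right by (auto simp: x_def Suc_le_eq simp del: add_Suc_right)
  moreover have "(\<forall>d>0. 3 * d \<le> x \<and> x - 3 * d \<in> elements u
        \<longrightarrow> x - d \<in> elements u \<or> x - 2 * d \<in> elements u) \<longleftrightarrow> gap_free L L L"
    unfolding pos gap_free_iff mult
  proof (intro all_cong1)
    fix d
    show "(Suc (3 * d + 2) \<le> x \<and> x - Suc (3 * d + 2) \<in> elements u
        \<longrightarrow> x - Suc d \<in> elements u \<or> x - Suc (2 * d + 1) \<in> elements u)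
      \<longleftrightarrow> (d < length L \<and> 2 * d + 1 < length L \<and> 3 * d + 2 < length L
        \<longrightarrow> L ! d \<or> L ! (2 * d + 1) \<or> \<not> L ! (3 * d + 2))"
      using left[of d] left[of "2 * d + 1"] left[of "3 * d + 2"]
      by (cases "3 * d + 2 < length L") (auto simp: x_def)
  qed
  moreover have "(\<forall>d>0. x + 3 * d < length u \<and> x + 3 * d \<in> elements u
        \<longrightarrow> x + d \<in> elements u \<or> x + 2 * d \<in> elements u) \<longleftrightarrow> gap_free R R R"
    unfolding pos gap_free_iff mult
  proof (intro all_cong1)
    fix d
    show "(x + Suc (3 * d + 2) < length u \<and> x + Suc (3 * d + 2) \<in> elements u
        \<longrightarrow> x + Suc d \<in> elements u \<or> x + Suc (2 * d + 1) \<in> elements u)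
      \<longleftrightarrow> (d < length R \<and> 2 * d + 1 < length R \<and> 3 * d + 2 < length R
        \<longrightarrow> R ! d \<or> R ! (2 * d + 1) \<or> \<not> R ! (3 * d + 2))"
      using right[of d] right[of "2 * d + 1"] right[of "3 * d + 2"]
      by (cases "3 * d + 2 < length R") (auto simp: len simp del: add_Suc_right)
  qed
  ultimately show ?thesis
    using here unfolding admissible_def u_def[symmetric] x_def[symmetric] by (simp add: len)
qed

text \<open>A trie maps the bit strings of the reached sets to their numbers of paths; \<open>Tip b w\<close> is a path
  without branching. \<open>Alt\<close> absorbs the junk case of strings of different lengths and never occurs
  in the computation; it makes the lemmas on weights unconditional.\<close>

datatype trie = Emp | Tip "bool list" num | Node trie trie | Alt trie trie

text \<open>The sum of \<open>f\<close> over the stored bit strings, counted with multiplicity.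
  Leaving \<open>f\<close> arbitrary specifies the trie operations without any invariant on the
  shape of a trie.\<close>

fun weight :: "trie \<Rightarrow> (bool list \<Rightarrow> nat) \<Rightarrow> nat" where
  "weight Emp f = 0"
| "weight (Tip b w) f = numeral w * f b"
| "weight (Node l r) f = weight l (\<lambda>b. f (False # b)) + weight r (\<lambda>b. f (True # b))"
| "weight (Alt s t) f = weight s f + weight t f"

fun ins :: "bool list \<Rightarrow> num \<Rightarrow> trie \<Rightarrow> trie" where
  "ins b w Emp = Tip b w"
| "ins (False # b) w (Node l r) = Node (ins b w l) r"
| "ins (True # b) w (Node l r) = Node l (ins b w r)"
| "ins (False # b) w (Tip (False # c) v) = Node (ins b w (Tip c v)) Emp"
| "ins (False # b) w (Tip (True # c) v) = Node (Tip b w) (Tip c v)"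
| "ins (True # b) w (Tip (False # c) v) = Node (Tip c v) (Tip b w)"
| "ins (True # b) w (Tip (True # c) v) = Node Emp (ins b w (Tip c v))"
| "ins [] w (Tip [] v) = Tip [] (w + v)"
| "ins b w t = Alt (Tip b w) t"

fun union :: "trie \<Rightarrow> trie \<Rightarrow> trie" where
  "union Emp t = t"
| "union (Tip b w) t = ins b w t"
| "union (Node l r) Emp = Node l r"
| "union (Node l r) (Tip b w) = ins b w (Node l r)"
| "union (Node l r) (Node l' r') = Node (union l l') (union r r')"
| "union s t = Alt s t"

lemma weight_ins: "weight (ins b w t) f = numeral w * f b + weight t f"
  by (induction b w t arbitrary: f rule: ins.induct) (auto simp flip: distrib_right)

lemma weight_union: "weight (union s t) f = weight s f + weight t f"
  by (induction s t arbitrary: f rule: union.induct) (auto simp: weight_ins)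

text \<open>The three checks of a move are separate functions of a Boolean so that rewriting evaluates a
  check only after the previous one has succeeded.\<close>

definition add_move :: "bool \<Rightarrow> bool list \<Rightarrow> bool list \<Rightarrow> num \<Rightarrow> trie \<Rightarrow> trie" where
  "add_move ok L R w t = (if ok then ins (rev_onto L (True # R)) w t else t)"

definition check_right :: "bool \<Rightarrow> bool list \<Rightarrow> bool list \<Rightarrow> num \<Rightarrow> trie \<Rightarrow> trie" where
  "check_right ok L R w t = (if ok then add_move (gap_free R R R) L R w t else t)"

definition check_left :: "bool \<Rightarrow> bool list \<Rightarrow> bool list \<Rightarrow> num \<Rightarrow> trie \<Rightarrow> trie" where
  "check_left ok L R w t = (if ok then check_right (gap_free L L L) L R w t else t)"

text \<open>The state is a zipper: the bits before the current position in reverse, and those after it.\<close>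

fun moves :: "bool list \<Rightarrow> bool list \<Rightarrow> num \<Rightarrow> trie \<Rightarrow> trie" where
  "moves [] R w t = t"
| "moves (True # L) R w t = moves L (True # R) w t"
| "moves (False # L) R w t = moves L (False # R) w (check_left (agree L R) L R w t)"

text \<open>The argument \<open>p\<close> collects the path from the root in reverse, so at a tip
  \<open>rev_onto b p\<close> is the whole bit string reversed, which is the zipper at its right
  end.\<close>

fun step :: "trie \<Rightarrow> bool list \<Rightarrow> trie" where
  "step Emp p = Emp"
| "step (Node l r) p = union (step l (False # p)) (step r (True # p))"
| "step (Alt s t) p = union (step s p) (step t p)"
| "step (Tip b w) p = moves (rev_onto b p) [] w Emp"

text \<open>The list only serves as a unary counter.\<close>

fun run :: "bool list \<Rightarrow> trie \<Rightarrow> trie" where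
  "run [] t = t"
| "run (x # xs) t = run xs (step t [])"

fun total :: "trie \<Rightarrow> nat" where
  "total Emp = 0"
| "total (Node l r) = total l + total r"
| "total (Alt s t) = total s + total t"
| "total (Tip b w) = numeral w"

section \<open>Correctness of the trie computation\<close>

text \<open>The scan runs leftwards and never changes the underlying string \<open>u\<close>. Each
  position passed adds its summand exactly when the tests of \<open>admissible_zipper\<close>
  succeed.\<close>

lemma weight_moves:
  fixes L R
  defines "u \<equiv> rev L @ R"
  shows "weight (moves L R w t) f = weight t f
     + numeral w * (\<Sum>i | i < length L \<and> admissible (length u) (elements u) i. f (u[i := True]))"
  unfolding u_def
proof (induction L arbitrary: R t)
  case Nil
  thus ?case by simp
next
  case (Cons a L)
  define u where "u = rev L @ a # R"
  define ok where "ok \<longleftrightarrow> \<not> a \<and> agree L R \<and> gap_free L L L \<and> gap_free R R R"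
  let ?A = "\<lambda>k. {i. i < k \<and> admissible (length u) (elements u) i}"
  have "?A (length (a # L)) = (if ok then insert (length L) (?A (length L)) else ?A (length L))"
    using admissible_zipper[of L a R] unfolding ok_def u_def by (auto simp: less_Suc_eq)
  hence "(\<Sum>i\<in>?A (length (a # L)). f (u[i := True]))
    = (if ok then f (u[length L := True]) else 0) + (\<Sum>i\<in>?A (length L). f (u[i := True]))"
    by simp
  moreover have "u[length L := True] = rev L @ True # R"
    unfolding u_def by (simp add: list_update_append)
  moreover have "weight (moves (a # L) R w t) f
    = weight (moves L (a # R) w (if ok then ins (rev L @ True # R) w t else t)) f"
    unfolding ok_def
    by (cases a) (simp_all add: check_left_def check_right_def add_move_def rev_onto_eq)
  ultimately show ?case
    using Cons.IH[of "a # R"] by (simp add: u_def[symmetric] weight_ins algebra_simps)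
qed

lemma weight_step:
  "weight (step t p) f = weight t (\<lambda>b. let u = rev p @ b in
     \<Sum>i | admissible (length u) (elements u) i. f (u[i := True]))"
proof (induction t p arbitrary: f rule: step.induct)
  case (4 b w p)
  have "{i. i < length (rev_onto b p) \<and> admissible (length (rev p @ b)) (elements (rev p @ b)) i}
      = {i. admissible (length (rev p @ b)) (elements (rev p @ b)) i}"
    by (auto simp: rev_onto_eq admissible_def)
  thus ?case
    by (simp add: weight_moves rev_onto_eq Let_def)
qed (auto simp: weight_union)

text \<open>Pushing a trie forward by one step amounts to replacing \<open>f\<close> by its sum over
  all moves. Starting from the constant 1, this is the recursion \<open>card_extensions_Suc\<close>
  for the number of continuations.\<close>

lemma weight_run:
  "weight (run xs t) (\<lambda>_. 1)
     = weight t (\<lambda>u. card (extensions (length u) (length xs) (elements u)))"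
proof (induction xs arbitrary: t)
  case Nil
  thus ?case by (simp add: extensions_0)
next
  case (Cons x xs)
  have "(\<Sum>i | admissible (length u) (elements u) i. card (extensions (length u) (length xs) (elements (u[i := True]))))
    = card (extensions (length u) (Suc (length xs)) (elements u))" for u
    unfolding card_extensions_Suc
    by (rule sum.cong) (simp_all add: elements_update admissible_less)
  thus ?case by (simp add: Cons.IH weight_step Let_def del: One_nat_def)
qed

lemma total_eq_weight: "total t = weight t (\<lambda>_. 1)"
  by (induction t) auto

text \<open>The initial trie holds the empty set with a single path; after \<open>n\<close> steps
  the weights add up to the number of complete paths.\<close>

lemma theta_eq_total: "theta n = total (run (replicate n False) (Tip (replicate n False) num.One))"
proof -
  have "elements (replicate n False) = {}" by (auto simp: elements_def)
  thus ?thesis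
    by (simp add: total_eq_weight weight_run theta_eq_card_admissible_seq extensions_def
        del: One_nat_def)
qed

section \<open>Rewrite rules for evaluating \<open>theta\<close> at numerals\<close>

lemma replicate_numeral: "replicate (numeral k) x = x # replicate (pred_numeral k) x"
  by (simp add: numeral_eq_Suc)

lemma replicate_1: "replicate 1 x = [x]"
  by simp

text \<open>Comparing two bits per step saves about half of the most frequent rewrites.\<close>

lemma agree_chunks:
  "agree [] r = True" "agree (a # l) [] = True"
  "agree (True # l) (False # r) = False"
  "agree (False # l) (True # r) = False"
  "agree [True] (True # r) = True" "agree [False] (False # r) = True"
  "agree (True # b # l) [True] = True" "agree (False # b # l) [False] = True"
  "agree (True # True # l) (True # True # r) = agree l r"
  "agree (False # True # l) (False # True # r) = agree l r"
  "agree (True # False # l) (True # False # r) = agree l r"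
  "agree (False # False # l) (False # False # r) = agree l r"
  "agree (a # True # l) (b # False # r) = False"
  "agree (a # False # l) (b # True # r) = False"
  by simp_all

lemma gap_free_bits:
  "gap_free (True # p) (x # b # q) (y # z # c # r) = gap_free p q r"
  "gap_free (False # p) (x # True # q) (y # z # c # r) = gap_free p q r"
  "gap_free (False # p) (x # False # q) (y # z # False # r) = gap_free p q r"
  "gap_free (False # p) (x # False # q) (y # z # True # r) = False"
  "gap_free p q [] = True" "gap_free p q [y] = True" "gap_free p q [y, z] = True"
  by simp_all

lemma check_bits:
  "check_left True L R w t = check_right (gap_free L L L) L R w t" "check_left False L R w t = t"
  "check_right True L R w t = add_move (gap_free R R R) L R w t" "check_right False L R w t = t"
  "add_move True L R w t = ins (rev_onto L (True # R)) w t" "add_move False L R w t = t"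
  by (simp_all add: check_left_def check_right_def add_move_def)

lemmas theta_eval =
  theta_eq_total replicate_1 replicate_numeral pred_numeral_simps BitM.simps replicate_0
  run.simps step.simps moves.simps check_bits agree_chunks gap_free_bits rev_onto.simps
  union.simps(1-5) ins.simps(1-8) add_num_simps total.simps add_0 add_0_right

section \<open>Values and bounds\<close>

lemma theta_1_to_23:
  "theta 1 = 1" "theta 2 = 2" "theta 3 = 4" "theta 4 = 10" "theta 5 = 20" "theta 6 = 48"
  "theta 7 = 104" "theta 8 = 282" "theta 9 = 496" "theta 10 = 1066" "theta 11 = 2460"
  "theta 12 = 6128" "theta 13 = 12840" "theta 14 = 29380" "theta 15 = 74904"
  "theta 16 = 212728" "theta 17 = 368016" "theta 18 = 659296" "theta 19 = 1371056"
  "theta 20 = 2937136" "theta 21 = 6637232" "theta 22 = 15616616" "theta 23 = 38431556"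
  by (simp_all only: theta_eval)

lemma theta_24: "theta 24 = 96547832"
  by (simp only: theta_eval)

lemma theta_25: "theta 25 = 198410168"
  by (simp only: theta_eval)

lemma theta_26: "theta 26 = 419141312"
  by (simp only: theta_eval)

lemma theta_27: "theta 27 = 941812088"
  by (simp only: theta_eval)

lemma theta_28: "theta 28 = 2181990978"
  by (simp only: theta_eval)

lemma theta_36: "theta 36 = 1144978334240"
  by (simp only: theta_eval)

lemma theta_37: "theta 37 = 2362611440576"
  by (simp only: theta_eval)

lemma theta_38: "theta 38 = 4911144118024"
  by (simp only: theta_eval)

lemma theta_39: "theta 39 = 10417809568016"
  by (simp only: theta_eval)

lemma theta_40: "theta 40 = 22388184630824"
  by (simp only: theta_eval)

lemma theta_41: "theta 41 = 50301508651032"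
  by (simp only: theta_eval)

lemma theta_42: "theta 42 = 113605533519568"
  by (simp only: theta_eval)

lemma theta_43: "theta 43 = 265157938869936"
  by (simp only: theta_eval)

lemma theta_44: "theta 44 = 622473467900178"
  by (simp only: theta_eval)

lemmas theta_values = theta_1_to_23 theta_24 theta_25 theta_26 theta_27 theta_28
  theta_36 theta_37 theta_38 theta_39 theta_40 theta_41 theta_42 theta_43 theta_44

text \<open>Exact values, except that the entries 29 to 35 are the products of two smaller values
  given by the doubling inequality; entry 0 is a dummy.\<close>

definition theta_bounds :: "nat list" where
  "theta_bounds = [
    0, 1, 2, 4, 10, 20, 48, 104, 282, 496, 1066, 2460, 6128, 12840, 29380, 74904,
    212728, 368016, 659296, 1371056, 2937136, 6637232, 15616616, 38431556, 96547832,
    198410168, 419141312, 941812088, 2181990978, 4401359040, 11221218432, 31868356224,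
    90506403968, 156574615296, 270871552512, 485262953472, 1144978334240, 2362611440576,
    4911144118024, 10417809568016, 22388184630824, 50301508651032, 113605533519568,
    265157938869936, 622473467900178]"

lemma theta_bounds_le:
  assumes "n < 45"
  shows "theta_bounds ! n \<le> theta n"
proof -
  have "[0..<45] = 0 # 1 # [2..<45]"
    by (simp add: upt_conv_Cons)
  \<comment> \<open>The instances of \<open>theta_add\<close> supply the entries 29 to 35 in
    turn.\<close>
  moreover have "list_all2 (\<le>) theta_bounds (map theta (0 # 1 # [2..<45]))"
    using theta_add[of 15 14] theta_add[of 15 15] theta_add[of 16 15] theta_add[of 16 16]
      theta_add[of 17 16] theta_add[of 17 17] theta_add[of 18 17]
    by (simp add: theta_bounds_def theta_values del: One_nat_def)
  ultimately have "list_all2 (\<le>) theta_bounds (map theta [0..<45])"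
    by (simp only:)
  from list_all2_nthD2[OF this, of n] show ?thesis
    using assms by simp
qed

text \<open>The two halves of \<open>n\<close> differ by at most 1, as \<open>theta_add\<close>
  requires.\<close>

lemma theta_halves: "2 * (theta (n - n div 2) * theta (n div 2)) \<le> theta n" if "n \<ge> 2"
proof -
  have "n - n div 2 = n div 2 \<or> n - n div 2 = Suc (n div 2)" "n div 2 > 0" using that by auto
  from theta_add[OF this] show ?thesis by simp
qed

text \<open>The fraction \<open>179 / 83\<close> exceeds \<open>c4\<close> by less than a factor of 1.0001; the claim for 79 leaves
  a margin of less than two percent. From 40 on, the exact factor \<open>c4 ^ 40 = theta 40\<close> is split off
  because the claim for 40 is an equality.\<close>

lemma theta_ge_below_40:
  assumes "1 \<le> n" "n < 40"
  shows "n * 179 ^ n \<le> 40 * theta n * 83 ^ n"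
proof -
  have "[1..<40] = 1 # [2..<40]"
    by (simp add: upt_conv_Cons)
  moreover have "list_all (\<lambda>n. n * 179 ^ n \<le> 40 * theta_bounds ! n * 83 ^ n) (1 # [2..<40])"
    by (simp add: theta_bounds_def)
  ultimately have "list_all (\<lambda>n. n * 179 ^ n \<le> 40 * theta_bounds ! n * 83 ^ n) [1..<40]"
    by (simp only:)
  hence "n * 179 ^ n \<le> 40 * theta_bounds ! n * 83 ^ n"
    using assms by (simp only: list_all_iff set_upt atLeastLessThan_iff simp_thms)
  moreover have "40 * theta_bounds ! n * 83 ^ n \<le> 40 * theta n * 83 ^ n"
    using assms by (intro mult_right_mono mult_left_mono theta_bounds_le) auto
  ultimately show ?thesis by (rule order_trans)
qed

lemma theta_ge_below_80:
  assumes "40 \<le> n" "n < 80"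
  shows "n * 179 ^ (n - 40) * theta 40 \<le> 40 * theta n * 83 ^ (n - 40)"
proof (cases "n < 45")
  case True
  have "list_all (\<lambda>n. n * 179 ^ (n - 40) * 22388184630824
      \<le> 40 * theta_bounds ! n * 83 ^ (n - 40)) [40..<45]"
    by (simp add: theta_bounds_def)
  hence "n * 179 ^ (n - 40) * theta 40 \<le> 40 * theta_bounds ! n * 83 ^ (n - 40)"
    using assms True by (simp only: theta_40 list_all_iff set_upt atLeastLessThan_iff simp_thms)
  moreover have "40 * theta_bounds ! n * 83 ^ (n - 40) \<le> 40 * theta n * 83 ^ (n - 40)"
    using True by (intro mult_right_mono mult_left_mono theta_bounds_le) auto
  ultimately show ?thesis by (rule order_trans)
next
  case False
  \<comment> \<open>For \<open>n\<close> from 45 to 79 both halves lie between 22 and 40, so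
    \<open>theta_bounds\<close> covers them.\<close>
  have "list_all (\<lambda>n. n * 179 ^ (n - 40) * 22388184630824
      \<le> 40 * (2 * (theta_bounds ! (n - n div 2) * theta_bounds ! (n div 2))) * 83 ^ (n - 40))
      [45..<80]"
    by (simp add: theta_bounds_def)
  hence "n * 179 ^ (n - 40) * theta 40
      \<le> 40 * (2 * (theta_bounds ! (n - n div 2) * theta_bounds ! (n div 2))) * 83 ^ (n - 40)"
    using assms False
    by (simp only: theta_40 list_all_iff set_upt atLeastLessThan_iff not_less simp_thms)
  moreover have "2 * (theta_bounds ! (n - n div 2) * theta_bounds ! (n div 2)) \<le> theta n"
    using assms theta_halves[of n] mult_le_mono[OF theta_bounds_le theta_bounds_le, of "n - n div 2" "n div 2"]
    by linarith
  hence "40 * (2 * (theta_bounds ! (n - n div 2) * theta_bounds ! (n div 2))) * 83 ^ (n - 40)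
      \<le> 40 * theta n * 83 ^ (n - 40)"
    by (intro mult_right_mono mult_left_mono) auto
  ultimately show ?thesis by (rule order_trans)
qed

section \<open>Bounds on \<open>c4\<close> and strong induction by halving\<close>

theorem theorem4:
  fixes c4 :: real
  assumes c4: "c4 = root 40 (real (theta 40))"
  shows "theta 40 = 22388184630824
    \<and> 2.156 \<le> c4 \<and> c4 < 2.157
    \<and> (\<forall>n::nat. n \<ge> 1 \<longrightarrow> real (theta n) \<ge> real n * c4 ^ n / 40)"
proof -
  have pow: "c4 ^ 40 = real (theta 40)"
    unfolding c4 by simp
  have nonneg: "c4 \<ge> 0"
    unfolding c4 by simp
  have lower: "2.156 \<le> c4"
  proof (rule ccontr)
    assume "\<not> ?thesis"
    hence "c4 ^ 40 < 2.156 ^ 40"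
      using nonneg by (intro power_strict_mono) auto
    thus False unfolding pow theta_40 by (simp add: power_divide)
  qed
  have upper: "c4 < 179 / 83"
  proof (rule ccontr)
    assume "\<not> ?thesis"
    hence "(179 / 83) ^ 40 \<le> c4 ^ 40"
      by (intro power_mono) auto
    thus False unfolding pow theta_40 by (simp add: power_divide)
  qed
  \<comment> \<open>This clears denominators, so that the integer inequalities below 80 apply to the
    real number \<open>c4\<close>.\<close>
  have pow_le: "c4 ^ k * 83 ^ k \<le> 179 ^ k" for k
    using power_mono[of "c4 * 83" 179 k] upper nonneg by (simp add: power_mult_distrib)
  have main: "real n * c4 ^ n \<le> 40 * real (theta n)" if "n \<ge> 1" for n
    using that
  proof (induction n rule: less_induct)
    case (less n)
    consider "n < 40" | "40 \<le> n" "n < 80" | "n \<ge> 80" by linarith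
    thus ?case
    proof cases
      case 1
      have "real n * c4 ^ n * 83 ^ n \<le> real n * 179 ^ n"
        using mult_left_mono[OF pow_le[of n], of "real n"] by (simp add: mult.assoc)
      also have "\<dots> \<le> 40 * real (theta n) * 83 ^ n"
        using of_nat_mono[OF theta_ge_below_40[OF less.prems 1], where 'a = real] by simp
      finally show ?thesis by simp
    next
      case 2
      have "c4 ^ n = real (theta 40) * c4 ^ (n - 40)"
        unfolding pow[symmetric] power_add[symmetric] using 2 by simp
      hence "real n * c4 ^ n * 83 ^ (n - 40)
          = real n * real (theta 40) * (c4 ^ (n - 40) * 83 ^ (n - 40))"
        by simp
      also have "\<dots> \<le> real n * real (theta 40) * 179 ^ (n - 40)"
        by (intro mult_left_mono pow_le) auto
      also have "\<dots> \<le> 40 * real (theta n) * 83 ^ (n - 40)"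
        using of_nat_mono[OF theta_ge_below_80[OF 2], where 'a = real] by (simp add: mult_ac)
      finally show ?thesis by simp
    next
      case 3
      define k where "k = n div 2"
      define m where "m = n - n div 2"
      have n: "n = m + k" and km: "k \<ge> 40" "m \<ge> 40" "m < n" "k < n"
        using 3 unfolding k_def m_def by auto
      \<comment> \<open>Each summand on the left is at most \<open>m * k\<close>, since both halves
        are at least 40. This absorbs the second factor 40 that arises when the claims for
        \<open>m\<close> and \<open>k\<close> are multiplied.\<close>
      have "40 * m + 40 * k \<le> m * k + m * k"
        using km by (intro add_mono) simp_all
      hence "40 * (m + k) \<le> 2 * (m * k)"
        by (simp only: distrib_left mult_2)
      hence "40 * real n \<le> 2 * (real m * real k)"
        unfolding n using of_nat_mono[where 'a = real] by fastforce
      hence "40 * real n * c4 ^ n \<le> 2 * (real m * real k) * c4 ^ n"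
        using nonneg by (intro mult_right_mono) auto
      also have "\<dots> = 2 * ((real m * c4 ^ m) * (real k * c4 ^ k))"
        unfolding n power_add by (simp add: mult_ac)
      also have "\<dots> \<le> 2 * ((40 * real (theta m)) * (40 * real (theta k)))"
        by (intro mult_left_mono mult_mono[OF less.IH[of m] less.IH[of k]]) (use km nonneg in auto)
      also have "\<dots> = 1600 * real (2 * (theta m * theta k))"
        by simp
      also have "\<dots> \<le> 1600 * real (theta n)"
        using theta_halves[of n] 3 unfolding m_def k_def by (intro mult_left_mono of_nat_mono) auto
      finally show ?thesis by simp
    qed
  qed
  show ?thesis
    using theta_40 lower upper main by (auto simp: field_simps)
qed

end
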